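(* Let $V$ be uniformly distributed in the rectangle $\mathfrak{R}(o)=[-\ell_x/2,\ell_x/2]\times[-\ell_y/2,\ell_y/2]$, with $\ell_x,\ell_y>0$, and let $u=(u_x,u_y)$ be a fixed reference point with $|u_x|<\ell_x/2$ and $|u_y|<\ell_y/2$. Let $(R,\Theta)$ be the distance and azimuth angle of $V$ as seen from $u$, i.e. $V-u=(R\cos\Theta,R\sin\Theta)$ with $R\ge 0$, $\Theta\in[0,2\pi)$. Then for all $r>0$ and $\theta\in[0,2\pi]$ the joint CDF $F_{R,\Theta}(r,\theta)=\Pr(R\le r,\Theta\le\theta)$ equals $$F_{R,\Theta}(r,\theta)=\frac{r^2}{2\ell_x\ell_y}\sum_{i=1}^{8}\Big[\mathbf 1(r<h_i)\big(\min(\theta,\chi^{(<)}_{i,2})-\chi^{(<)}_{i,1}\big)^+ +\mathbf 1(r\ge h_i)\big(\min(\theta,\chi^{(\ge)}_{i,2}(r))-\chi^{(\ge)}_{i,1}(r)\big)^+\Big]$$ $$\quad+\sum_{i=1}^{4}\frac{h_i^2}{2\ell_x\ell_y}\mathbf 1(r\ge h_i)\,\mathbb F\big(\tan;\mu_{i,1}(r);\min(\theta,\mu_{i,2}(r))\big)-\sum_{i=5}^{8}\frac{h_i^2}{2\ell_x\ell_y}\mathbf 1(r\ge h_i)\,\mathbb F\big(\cot;\mu_{i,1}(r);\min(\theta,\mu_{i,2}(r))\big),$$ with $h_i,\chi^{(<)}_{i,j},\chi^{(\ge)}_{i,j}(r),\mu_{i,j}(r)$ and the operator $\mathbb F$ as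 defined in the context.
   Context: Notation: $(x)^+=\max\{0,x\}$; $\mathbf 1(\cdot)$ is the indicator of a condition, and a term multiplied by an indicator equal to $0$ is read as $0$ (even if its other factor is undefined). For a real function $f$, $\mathbb F(f;a;b)=f(b)-f(a)$ if $b\ge a$ and $0$ otherwise. $\cot=1/\tan=\cos/\sin$. Let $h_{x^+}=\frac{\ell_x}{2}-u_x$, $h_{x^-}=-\frac{\ell_x}{2}-u_x$, $h_{y^+}=\frac{\ell_y}{2}-u_y$, $h_{y^-}=-\frac{\ell_y}{2}-u_y$, and $(h_1,\dots,h_8)=(h_{x^+},h_{x^+},-h_{x^-},-h_{x^-},h_{y^+},h_{y^+},-h_{y^-},-h_{y^-})$. Let $\gamma_1=\arctan(h_{y^+}/h_{x^+})$, $\gamma_2=\arctan(h_{y^+}/h_{x^-})+\pi$, $\gamma_3=\arctan(h_{y^-}/h_{x^-})+\pi$, $\gamma_4=\arctan(h_{y^-}/h_{x^+})+2\pi$. The pairs $(\chi^{(<)}_{i,1},\chi^{(<)}_{i,2})$ for $i=1,\dots,8$ are: $(0,\gamma_1)$, $(\gamma_4,2\pi)$, $(\pi,\gamma_3)$, $(\gamma_2,\pi)$, $(\gamma_1,\frac{\pi}{2})$, $(\frac{\pi}{2},\gamma_2)$, $(\gamma_3,\frac{3\pi}{2})$, $(\frac{3\pi}{2},\gamma_4)$. For $r\ge h_i$, the pairs $(\chi^{(\ge)}_{i,1}(r),\chi^{(\ge)}_{i,2}(r))$ are: $i=1$: $(\arccos\frac{h_{x^+}}{r},\gamma_1)$;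 $i=2$: $(\gamma_4,2\pi-\arccos\frac{h_{x^+}}{r})$; $i=3$: $(2\pi-\arccos\frac{h_{x^-}}{r},\gamma_3)$; $i=4$: $(\gamma_2,\arccos\frac{h_{x^-}}{r})$; $i=5$: $(\gamma_1,\arcsin\frac{h_{y^+}}{r})$; $i=6$: $(\pi-\arcsin\frac{h_{y^+}}{r},\gamma_2)$; $i=7$: $(\gamma_3,\pi-\arcsin\frac{h_{y^-}}{r})$; $i=8$: $(2\pi+\arcsin\frac{h_{y^-}}{r},\gamma_4)$. For $r\ge h_i$, the pairs $(\mu_{i,1}(r),\mu_{i,2}(r))$ are: $i=1$: $(0,\min(\arccos\frac{h_{x^+}}{r},\gamma_1))$; $i=2$: $(\max(2\pi-\arccos\frac{h_{x^+}}{r},\gamma_4),2\pi)$; $i=3$: $(\pi,\min(2\pi-\arccos\frac{h_{x^-}}{r},\gamma_3))$; $i=4$: $(\max(\gamma_2,\arccos\frac{h_{x^-}}{r}),\pi)$; $i=5$: $(\max(\gamma_1,\arcsin\frac{h_{y^+}}{r}),\frac{\pi}{2})$; $i=6$: $(\frac{\pi}{2},\min(\pi-\arcsin\frac{h_{y^+}}{r},\gamma_2))$; $i=7$: $(\max(\gamma_3,\pi-\arcsin\frac{h_{y^-}}{r}),\frac{3\pi}{2})$; $i=8$: $(\frac{3\pi}{2},\min(2\pi+\arcsin\frac{h_{y^-}}{r},\gamma_4))$. *)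

theory Defs
  imports "HOL-Probability.Probability"
begin

text \<open>
  The rectangle has side lengths \<open>lx\<close>, \<open>ly\<close> and is centred at the origin; the reference point is
  \<open>(ux, uy)\<close>. Along one axis, \<open>h_plus l u\<close> and \<open>h_minus l u\<close> are the signed offsets of the two
  sides from the reference point, so \<open>h_minus l u < 0 < h_plus l u\<close> if \<open>\<bar>u\<bar> < l / 2\<close>.
\<close>

definition h_plus :: "real \<Rightarrow> real \<Rightarrow> real" where
  "h_plus l u = l / 2 - u"

definition h_minus :: "real \<Rightarrow> real \<Rightarrow> real" where
  "h_minus l u = - l / 2 - u"

text \<open>
  All families below are indexed by \<open>i \<in> {1..8}\<close>; values at other \<open>i\<close> carry no meaning.
\<close>

definition side_dist :: "real \<Rightarrow> real \<Rightarrow> real \<Rightarrow> real \<Rightarrow> nat \<Rightarrow> real" where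
  "side_dist lx ly ux uy i =
     [h_plus lx ux, h_plus lx ux, - h_minus lx ux, - h_minus lx ux,
      h_plus ly uy, h_plus ly uy, - h_minus ly uy, - h_minus ly uy] ! (i - 1)"

text \<open>
  The azimuth angles, in \<open>{0..2 * pi}\<close>, of the four corners, counterclockwise from the upper right.
\<close>

definition corner1 :: "real \<Rightarrow> real \<Rightarrow> real \<Rightarrow> real \<Rightarrow> real" where
  "corner1 lx ly ux uy = arctan (h_plus ly uy / h_plus lx ux)"

definition corner2 :: "real \<Rightarrow> real \<Rightarrow> real \<Rightarrow> real \<Rightarrow> real" where
  "corner2 lx ly ux uy = arctan (h_plus ly uy / h_minus lx ux) + pi"

definition corner3 :: "real \<Rightarrow> real \<Rightarrow> real \<Rightarrow> real \<Rightarrow> real" where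
  "corner3 lx ly ux uy = arctan (h_minus ly uy / h_minus lx ux) + pi"

definition corner4 :: "real \<Rightarrow> real \<Rightarrow> real \<Rightarrow> real \<Rightarrow> real" where
  "corner4 lx ly ux uy = arctan (h_minus ly uy / h_plus lx ux) + 2 * pi"

definition chi_less :: "real \<Rightarrow> real \<Rightarrow> real \<Rightarrow> real \<Rightarrow> nat \<Rightarrow> real \<times> real" where
  "chi_less lx ly ux uy i =
    (let g1 = corner1 lx ly ux uy; g2 = corner2 lx ly ux uy;
         g3 = corner3 lx ly ux uy; g4 = corner4 lx ly ux uy
     in [(0, g1), (g4, 2 * pi), (pi, g3), (g2, pi),
         (g1, pi / 2), (pi / 2, g2), (g3, 3 * pi / 2), (3 * pi / 2, g4)] ! (i - 1))"

text \<open>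
  The next two families are only meaningful for \<open>r \<ge> side_dist lx ly ux uy i\<close>, where the arguments
  of \<open>arccos\<close> and \<open>arcsin\<close> lie in \<open>{-1..1}\<close>.
\<close>

definition chi_ge :: "real \<Rightarrow> real \<Rightarrow> real \<Rightarrow> real \<Rightarrow> nat \<Rightarrow> real \<Rightarrow> real \<times> real" where
  "chi_ge lx ly ux uy i r =
    (let g1 = corner1 lx ly ux uy; g2 = corner2 lx ly ux uy;
         g3 = corner3 lx ly ux uy; g4 = corner4 lx ly ux uy;
         xp = h_plus lx ux; xm = h_minus lx ux; yp = h_plus ly uy; ym = h_minus ly uy
     in [(arccos (xp / r), g1),
         (g4, 2 * pi - arccos (xp / r)),
         (2 * pi - arccos (xm / r), g3),
         (g2, arccos (xm / r)),
         (g1, arcsin (yp / r)),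
         (pi - arcsin (yp / r), g2),
         (g3, pi - arcsin (ym / r)),
         (2 * pi + arcsin (ym / r), g4)] ! (i - 1))"

definition mu :: "real \<Rightarrow> real \<Rightarrow> real \<Rightarrow> real \<Rightarrow> nat \<Rightarrow> real \<Rightarrow> real \<times> real" where
  "mu lx ly ux uy i r =
    (let g1 = corner1 lx ly ux uy; g2 = corner2 lx ly ux uy;
         g3 = corner3 lx ly ux uy; g4 = corner4 lx ly ux uy;
         xp = h_plus lx ux; xm = h_minus lx ux; yp = h_plus ly uy; ym = h_minus ly uy
     in [(0, min (arccos (xp / r)) g1),
         (max (2 * pi - arccos (xp / r)) g4, 2 * pi),
         (pi, min (2 * pi - arccos (xm / r)) g3),
         (max g2 (arccos (xm / r)), pi),
         (max g1 (arcsin (yp / r)), pi / 2),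
         (pi / 2, min (pi - arcsin (yp / r)) g2),
         (max g3 (pi - arcsin (ym / r)), 3 * pi / 2),
         (3 * pi / 2, min (2 * pi + arcsin (ym / r)) g4)] ! (i - 1))"

definition pos_part :: "real \<Rightarrow> real" where
  "pos_part x = max 0 x"

definition incr :: "(real \<Rightarrow> real) \<Rightarrow> real \<Rightarrow> real \<Rightarrow> real" where
  "incr f a b = (if b \<ge> a then f b - f a else 0)"

end

theory Submission
  imports Defs
begin

text \<open>
  The rays to the corners together with the half-axes cut the rectangle, seen from the reference
  point, into eight right-angled wedges, each with one leg on a half-axis. Every wedge is carried by
  a signed coordinate permutation, which preserves Lebesgue measure, to the region below a line
  \<open>q = m * p\<close> in a strip \<open>0 < p \<le> h\<close>; there \<open>q = p * t\<close> turns the area of its part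
  in the disc of radius \<open>r\<close> into the integral of \<open>min h\<^sup>2 (r\<^sup>2 / (1 + t\<^sup>2)) / 2\<close> over the
  slopes \<open>t\<close>. The integrand switches branch at \<open>t = tan (arccos (h / r))\<close>, which produces the
  tangent and the angle terms of the formula. Each summand of the formula is thus the increment of
  the distribution function over one wedge, and these increments telescope.
\<close>

section \<open>Area of a wedge of a disc\<close>

text \<open>The strict bounds \<open>0 < p\<close> and \<open>0 < q\<close> leave out both
  half-axes, so that in polar coordinates the set is the half-open range of azimuths
  \<open>0 < x \<le> \<phi>\<close> when \<open>m = tan \<phi>\<close>.\<close>

definition sector :: "real \<Rightarrow> real \<Rightarrow> real \<Rightarrow> (real \<times> real) set" where
  "sector h r m = {(p, q). 0 < p \<and> p \<le> h \<and> 0 < q \<and> q \<le> m * p \<and> p\<^sup>2 + q\<^sup>2 \<le> r\<^sup>2}"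

lemma sector_measurable [measurable]: "sector h r m \<in> sets borel"
proof -
  have "sector h r m = {v \<in> space (borel \<Otimes>\<^sub>M borel).
      0 < fst v \<and> fst v \<le> h \<and> 0 < snd v \<and> snd v \<le> m * fst v \<and> (fst v)\<^sup>2 + (snd v)\<^sup>2 \<le> r\<^sup>2}"
    by (auto simp: sector_def space_pair_measure)
  also have "\<dots> \<in> sets (borel \<Otimes>\<^sub>M borel)" by measurable
  finally show ?thesis unfolding borel_prod .
qed

text \<open>The ray of slope \<open>t\<close> leaves the strip at \<open>p = h\<close> and the disc
  at \<open>p = r / sqrt (1 + t\<^sup>2)\<close>; this is half the square of the smaller
  abscissa.\<close>

definition slope_density :: "real \<Rightarrow> real \<Rightarrow> real \<Rightarrow> real" where
  "slope_density h r t = min (h\<^sup>2) (r\<^sup>2 / (1 + t\<^sup>2)) / 2"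

text \<open>The weight \<open>p\<close> is the Jacobian of \<open>q = p * t\<close>. For fixed
  \<open>t\<close> the admissible \<open>p\<close> form an interval starting at 0, on which
  \<open>p\<^sup>2 / 2\<close> is an antiderivative.\<close>

lemma nn_integral_radial:
  assumes "h > 0" "r > 0"
  shows "(\<integral>\<^sup>+p. ennreal p * indicator {p. 0 < p \<and> p \<le> h \<and> p\<^sup>2 * (1 + t\<^sup>2) \<le> r\<^sup>2} p \<partial>lborel)
    = ennreal (slope_density h r t)"
proof -
  define c where "c = min h (r / sqrt (1 + t\<^sup>2))"
  have pos: "1 + t\<^sup>2 > 0" by (simp add: add_pos_nonneg)
  have c0: "c > 0" using assms pos by (simp add: c_def)
  have iff: "p\<^sup>2 * (1 + t\<^sup>2) \<le> r\<^sup>2 \<longleftrightarrow> p \<le> r / sqrt (1 + t\<^sup>2)" if "p > 0" for p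
  proof -
    have "p\<^sup>2 * (1 + t\<^sup>2) = (p * sqrt (1 + t\<^sup>2))\<^sup>2" using pos by (simp add: power_mult_distrib)
    then have "p\<^sup>2 * (1 + t\<^sup>2) \<le> r\<^sup>2 \<longleftrightarrow> p * sqrt (1 + t\<^sup>2) \<le> r"
      using assms that pos by (simp add: power_mono_iff)
    also have "\<dots> \<longleftrightarrow> p \<le> r / sqrt (1 + t\<^sup>2)" using pos by (simp add: pos_le_divide_eq)
    finally show ?thesis .
  qed
  have "(\<integral>\<^sup>+p. ennreal p * indicator {p. 0 < p \<and> p \<le> h \<and> p\<^sup>2 * (1 + t\<^sup>2) \<le> r\<^sup>2} p \<partial>lborel)
      = (\<integral>\<^sup>+p. ennreal p * indicator {0..c} p \<partial>lborel)"
    by (intro nn_integral_cong) (auto simp: indicator_def c_def iff)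
  also have "\<dots> = ennreal (c\<^sup>2 / 2 - 0\<^sup>2 / 2)"
    by (intro nn_integral_FTC_Icc[where F="\<lambda>p. p\<^sup>2 / 2"])
       (use c0 in \<open>auto intro!: derivative_eq_intros\<close>)
  also have "c\<^sup>2 = min (h\<^sup>2) (r\<^sup>2 / (1 + t\<^sup>2))"
  proof -
    have "(r / sqrt (1 + t\<^sup>2))\<^sup>2 = r\<^sup>2 / (1 + t\<^sup>2)" using pos by (simp add: power_divide)
    moreover have "(min a b)\<^sup>2 = min (a\<^sup>2) (b\<^sup>2)" if "a \<ge> 0" "b \<ge> 0" for a b :: real
      using that by (auto simp: min_def power_mono_iff)
    ultimately show ?thesis using assms by (simp add: c_def)
  qed
  finally show ?thesis by (simp add: slope_density_def)
qed

text \<open>Slicing at constant \<open>p\<close>, substituting \<open>q = p * t\<close> in every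
  slice and exchanging the integrals leaves the radial integral for each slope.\<close>

lemma emeasure_sector_integral:
  assumes "h > 0" "r > 0"
  shows "emeasure lborel (sector h r m) =
    (\<integral>\<^sup>+t. ennreal (slope_density h r t) * indicator {0..m} t \<partial>lborel)"
proof -
  have slice: "emeasure lborel (Pair p -` sector h r m) =
     (\<integral>\<^sup>+t. ennreal p * indicator {0<..m} t * indicator {p. 0 < p \<and> p \<le> h \<and> p\<^sup>2 * (1 + t\<^sup>2) \<le> r\<^sup>2} p \<partial>lborel)"
    (is "_ = ?I") for p
  proof (cases "0 < p \<and> p \<le> h")
    case True
    have ms: "Pair p -` sector h r m \<in> sets borel"
      using sector_measurable[of h r m] unfolding borel_prod[symmetric] by (rule sets_Pair1)
    have "emeasure lborel (Pair p -` sector h r m) = (\<integral>\<^sup>+q. indicator (Pair p -` sector h r m) q \<partial>lborel)"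
      using ms by simp
    \<comment> \<open>Substitution \<open>q = p * t\<close>: the factor \<open>p\<close> gained here
      is the weight of the radial integral.\<close>
    also have "\<dots> = ennreal \<bar>p\<bar> * (\<integral>\<^sup>+t. indicator (Pair p -` sector h r m) (0 + p * t) \<partial>lborel)"
      using True ms by (intro nn_integral_real_affine) auto
    also have "\<dots> = (\<integral>\<^sup>+t. ennreal p * indicator (Pair p -` sector h r m) (0 + p * t) \<partial>lborel)"
      using True ms by (subst nn_integral_cmult) auto
    also have "\<dots> = ?I"
      using True by (intro nn_integral_cong)
        (auto simp: indicator_def sector_def algebra_simps power_mult_distrib zero_less_mult_iff)
    finally show ?thesis .
  next
    case False
    then have "Pair p -` sector h r m = {}" by (auto simp: sector_def)
    moreover have "?I = 0" using False by (auto simp: indicator_def intro!: nn_integral_zero')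
    ultimately show ?thesis by simp
  qed
  have "emeasure lborel (sector h r m) = (\<integral>\<^sup>+p. emeasure lborel (Pair p -` sector h r m) \<partial>lborel)"
    using sector_measurable[of h r m] unfolding borel_prod[symmetric]
    by (subst lborel_prod[symmetric], subst lborel.emeasure_pair_measure_alt) auto
  also have "\<dots> = (\<integral>\<^sup>+p. \<integral>\<^sup>+t. ennreal p * indicator {0<..m} t
      * indicator {p. 0 < p \<and> p \<le> h \<and> p\<^sup>2 * (1 + t\<^sup>2) \<le> r\<^sup>2} p \<partial>lborel \<partial>lborel)"
    by (simp add: slice)
  also have "\<dots> = (\<integral>\<^sup>+t. \<integral>\<^sup>+p. ennreal p * indicator {0<..m} t
      * indicator {p. 0 < p \<and> p \<le> h \<and> p\<^sup>2 * (1 + t\<^sup>2) \<le> r\<^sup>2} p \<partial>lborel \<partial>lborel)"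
    by (rule lborel_pair.Fubini') measurable
  also have "\<dots> = (\<integral>\<^sup>+t. indicator {0<..m} t * 
      (\<integral>\<^sup>+p. ennreal p * indicator {p. 0 < p \<and> p \<le> h \<and> p\<^sup>2 * (1 + t\<^sup>2) \<le> r\<^sup>2} p \<partial>lborel) \<partial>lborel)"
    by (subst nn_integral_cmult[symmetric]) (auto simp: mult_ac)
  also have "\<dots> = (\<integral>\<^sup>+t. ennreal (slope_density h r t) * indicator {0<..m} t \<partial>lborel)"
    using assms by (simp add: nn_integral_radial mult_ac)
  \<comment> \<open>Slope 0 is a null set; adding it gives the closed interval on which the integral
    is evaluated later.\<close>
  also have "\<dots> = (\<integral>\<^sup>+t. ennreal (slope_density h r t) * indicator {0..m} t \<partial>lborel)"
    by (intro nn_integral_cong_AE AE_I[where N="{0}"]) (auto simp: indicator_def)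
  finally show ?thesis .
qed

text \<open>For \<open>r < h\<close> the arc never reaches the side, and the region is a circular
  sector. Otherwise it is a right triangle with leg \<open>h\<close>, up to the angle
  \<open>arccos (h / r)\<close> where the side meets the circle, followed by a circular
  sector.\<close>

definition sector_area :: "real \<Rightarrow> real \<Rightarrow> real \<Rightarrow> real" where
  "sector_area h r \<phi> =
     (if r < h then r\<^sup>2 / 2 * \<phi>
      else h\<^sup>2 / 2 * tan (min \<phi> (arccos (h / r))) + r\<^sup>2 / 2 * max 0 (\<phi> - arccos (h / r)))"

text \<open>For these slopes the ray meets the side before the arc, so the integrand is
  constant.\<close>

lemma slope_density_integral_side:
  assumes "h > 0" "a \<le> b" "\<And>t. a \<le> t \<Longrightarrow> t \<le> b \<Longrightarrow> h\<^sup>2 * (1 + t\<^sup>2) \<le> r\<^sup>2"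
  shows "(slope_density h r has_integral h\<^sup>2 / 2 * (b - a)) {a..b}"
proof -
  have eq: "slope_density h r t = h\<^sup>2 / 2" if "t \<in> {a..b}" for t
  proof -
    have "1 + t\<^sup>2 > 0" by (simp add: add_pos_nonneg)
    then have "h\<^sup>2 \<le> r\<^sup>2 / (1 + t\<^sup>2)" using assms(3)[of t] that by (simp add: pos_le_divide_eq)
    then show ?thesis by (simp add: slope_density_def)
  qed
  have "((\<lambda>t. h\<^sup>2 / 2) has_integral measure lborel {a..b} *\<^sub>R (h\<^sup>2 / 2)) {a..b}"
    by (rule has_integral_const_real)
  then have "((\<lambda>t. h\<^sup>2 / 2) has_integral h\<^sup>2 / 2 * (b - a)) {a..b}"
    using assms(2) by (simp add: mult.commute)
  then show ?thesis by (rule has_integral_eq[rotated]) (simp add: eq)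
qed

text \<open>For these slopes the arc comes first, and \<open>arctan\<close> is an antiderivative up
  to the factor \<open>r\<^sup>2 / 2\<close>.\<close>

lemma slope_density_integral_arc:
  assumes "a \<le> b" "\<And>t. a \<le> t \<Longrightarrow> t \<le> b \<Longrightarrow> r\<^sup>2 \<le> h\<^sup>2 * (1 + t\<^sup>2)"
  shows "(slope_density h r has_integral r\<^sup>2 / 2 * (arctan b - arctan a)) {a..b}"
proof -
  have eq: "slope_density h r t = r\<^sup>2 / 2 * inverse (1 + t\<^sup>2)" if "t \<in> {a..b}" for t
  proof -
    have "1 + t\<^sup>2 > 0" by (simp add: add_pos_nonneg)
    then have "r\<^sup>2 / (1 + t\<^sup>2) \<le> h\<^sup>2" using assms(2)[of t] that by (simp add: pos_divide_le_eq)
    then show ?thesis by (simp add: slope_density_def field_simps)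
  qed
  have "((\<lambda>t. r\<^sup>2 / 2 * inverse (1 + t\<^sup>2)) has_integral (r\<^sup>2 / 2 * arctan b - r\<^sup>2 / 2 * arctan a)) {a..b}"
    using assms(1)
    by (intro fundamental_theorem_of_calculus)
       (auto intro!: derivative_eq_intros simp flip: has_real_derivative_iff_has_vector_derivative)
  then have "((\<lambda>t. r\<^sup>2 / 2 * inverse (1 + t\<^sup>2)) has_integral r\<^sup>2 / 2 * (arctan b - arctan a)) {a..b}"
    by (simp only: right_diff_distrib)
  then show ?thesis by (rule has_integral_eq[rotated]) (simp add: eq)
qed

lemma slope_density_integral:
  assumes "h > 0" "r > 0" "0 \<le> \<phi>" "\<phi> < pi / 2"
  shows "(slope_density h r has_integral sector_area h r \<phi>) {0..tan \<phi>}"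
proof -
  have tan0: "0 \<le> tan \<phi>" using assms by (simp add: tan_pos_pi2_le)
  show ?thesis
  proof (cases "r < h")
    case True
    have "r\<^sup>2 * 1 \<le> h\<^sup>2 * (1 + t\<^sup>2)" for t
      using True assms by (intro mult_mono power_mono) auto
    then have "(slope_density h r has_integral r\<^sup>2 / 2 * (arctan (tan \<phi>) - arctan 0)) {0..tan \<phi>}"
      using tan0 by (intro slope_density_integral_arc) auto
    then show ?thesis using True assms by (simp add: sector_area_def arctan_tan)
  next
    case False
    define \<alpha> where "\<alpha> = arccos (h / r)"
    have hr: "0 < h / r" "h / r \<le> 1" using False assms by auto
    have cos\<alpha>: "cos \<alpha> = h / r" unfolding \<alpha>_def using hr by (intro cos_arccos) linarith+
    have \<alpha>: "0 \<le> \<alpha>" "\<alpha> < pi / 2"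
    proof -
      show "0 \<le> \<alpha>" unfolding \<alpha>_def using hr by (intro arccos_lbound) linarith+
      have "arccos (h / r) < arccos 0" using hr by (intro arccos_less_arccos) linarith+
      then show "\<alpha> < pi / 2" by (simp add: \<alpha>_def)
    qed
    \<comment> \<open>The point with abscissa \<open>h\<close> and azimuth \<open>\<alpha>\<close>
      lies on the circle, so the two branches of the minimum agree at slope
      \<open>tan \<alpha>\<close>.\<close>
    have r_eq: "h\<^sup>2 * (1 + (tan \<alpha>)\<^sup>2) = r\<^sup>2"
      using tan_sec[of \<alpha>] cos\<alpha> assms by (simp add: field_simps)
    have tan\<alpha>: "0 \<le> tan \<alpha>" using \<alpha> by (simp add: tan_pos_pi2_le)
    have tan_mono: "tan x \<le> tan y" if "0 \<le> x" "x \<le> y" "y < pi / 2" for x y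
      using that by (cases "x = y") (auto intro!: less_imp_le tan_monotone)
    have side: "h\<^sup>2 * (1 + t\<^sup>2) \<le> r\<^sup>2" if "0 \<le> t" "t \<le> tan \<alpha>" for t
      unfolding r_eq[symmetric] using that by (intro mult_left_mono add_left_mono power_mono) auto
    have arc: "r\<^sup>2 \<le> h\<^sup>2 * (1 + t\<^sup>2)" if "tan \<alpha> \<le> t" for t
      unfolding r_eq[symmetric] using that tan\<alpha> by (intro mult_left_mono add_left_mono power_mono) auto
    have I1: "(slope_density h r has_integral h\<^sup>2 / 2 * tan (min \<phi> \<alpha>)) {0..tan (min \<phi> \<alpha>)}"
    proof -
      have "0 \<le> tan (min \<phi> \<alpha>)" using \<alpha> assms by (intro tan_pos_pi2_le) auto
      moreover have "tan (min \<phi> \<alpha>) \<le> tan \<alpha>" using \<alpha> assms by (intro tan_mono) auto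
      ultimately show ?thesis
        using slope_density_integral_side[of h 0 "tan (min \<phi> \<alpha>)" r] assms side by auto
    qed
    \<comment> \<open>For \<open>\<phi> \<le> \<alpha>\<close> the interval shrinks to a point and
      the arc contributes nothing.\<close>
    have I2: "(slope_density h r has_integral r\<^sup>2 / 2 * max 0 (\<phi> - \<alpha>)) {tan (min \<phi> \<alpha>)..tan \<phi>}"
    proof (cases "\<phi> \<le> \<alpha>")
      case False
      then have "(slope_density h r has_integral r\<^sup>2 / 2 * (arctan (tan \<phi>) - arctan (tan \<alpha>))) {tan \<alpha>..tan \<phi>}"
        using \<alpha> assms arc by (intro slope_density_integral_arc tan_mono) auto
      with False \<alpha> assms show ?thesis by (simp add: arctan_tan min_def max_def)
    qed (simp add: has_integral_refl)
    have "(slope_density h r has_integral (h\<^sup>2 / 2 * tan (min \<phi> \<alpha>) + r\<^sup>2 / 2 * max 0 (\<phi> - \<alpha>))) {0..tan \<phi>}"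
      by (rule has_integral_combine[OF _ _ I1 I2]) (use \<alpha> assms in \<open>auto intro!: tan_pos_pi2_le tan_mono\<close>)
    then show ?thesis using False by (simp add: sector_area_def \<alpha>_def)
  qed
qed

lemma measure_sector:
  assumes "h > 0" "r > 0" "0 \<le> \<phi>" "\<phi> < pi / 2"
  shows "measure lborel (sector h r (tan \<phi>)) = sector_area h r \<phi>"
proof -
  have nn: "slope_density h r t \<ge> 0" for t
    by (auto simp: slope_density_def intro!: divide_nonneg_nonneg)
  have meas [measurable]: "slope_density h r \<in> borel_measurable borel"
    unfolding slope_density_def by measurable
  have int: "(slope_density h r has_integral sector_area h r \<phi>) {0..tan \<phi>}"
    by (rule slope_density_integral[OF assms])
  have "(\<integral>\<^sup>+t. ennreal (slope_density h r t) * indicator {0..tan \<phi>} t \<partial>lborel) = ennreal (sector_area h r \<phi>)"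
  proof -
    have "((\<lambda>t. slope_density h r t * indicator {0..tan \<phi>} t) has_integral sector_area h r \<phi>) UNIV"
      using int by (subst (asm) has_integral_restrict_UNIV[symmetric])
        (simp add: indicator_def of_bool_def if_distrib cong: if_cong)
    then have "(\<integral>\<^sup>+t. ennreal (slope_density h r t * indicator {0..tan \<phi>} t) \<partial>lborel) = ennreal (sector_area h r \<phi>)"
      by (intro nn_integral_has_integral_lborel) (auto simp: nn)
    then show ?thesis by (simp add: ennreal_mult' ennreal_indicator nn)
  qed
  then have "emeasure lborel (sector h r (tan \<phi>)) = ennreal (sector_area h r \<phi>)"
    using assms by (simp add: emeasure_sector_integral)
  moreover have "0 \<le> sector_area h r \<phi>" using int nn by (rule has_integral_nonneg)
  ultimately show ?thesis by (simp add: measure_def)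
qed

section \<open>Uniform distributions on boxes\<close>

text \<open>The swap and the reflection of one coordinate generate all eight signed coordinate
  permutations, so these two maps are the only ones whose invariance is checked by hand.\<close>

lemma lborel_distr_swap: "distr lborel borel (\<lambda>v. (snd v, fst v)) = (lborel :: (real \<times> real) measure)"
proof -
  have "distr lborel borel (\<lambda>v. (snd v, fst v)) =
      distr (lborel \<Otimes>\<^sub>M lborel) (lborel \<Otimes>\<^sub>M lborel) (\<lambda>(x :: real, y :: real). (y, x))"
    by (intro distr_cong) (simp_all only: lborel_prod sets_lborel case_prod_beta')
  also have "\<dots> = lborel \<Otimes>\<^sub>M lborel" by (rule lborel_pair.distr_pair_swap[symmetric])
  finally show ?thesis by (simp only: lborel_prod)
qed

lemma lborel_distr_reflect: "distr lborel borel (\<lambda>v. (- fst v, snd v)) = (lborel :: (real \<times> real) measure)"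
proof -
  have "distr lborel borel (\<lambda>v. (- fst v, snd v)) =
      distr (lborel \<Otimes>\<^sub>M lborel) (lborel \<Otimes>\<^sub>M lborel) (\<lambda>(x :: real, y :: real). (- x, y))"
    by (intro distr_cong) (simp_all only: lborel_prod sets_lborel case_prod_beta')
  also have "\<dots> = distr lborel lborel uminus \<Otimes>\<^sub>M distr lborel lborel (\<lambda>x. x)"
    by (rule pair_measure_distr[symmetric]) (auto simp: distr_id lborel.sigma_finite_measure_axioms)
  also have "distr lborel lborel uminus = distr lborel borel (uminus :: real \<Rightarrow> real)"
    by (intro distr_cong) auto
  also have "\<dots> = lborel" by (rule lborel_distr_uminus)
  also have "distr lborel lborel (\<lambda>x. x :: real) = lborel"
    by (rule distr_id2) auto
  finally show ?thesis by (simp only: lborel_prod)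
qed

text \<open>Since \<open>K\<close> is a left inverse of \<open>L\<close>, the set \<open>A\<close>
  is the \<open>L\<close>-preimage of \<open>K -\<close>
  A\<open>, and likewise for its intersection with\<close>L -\<open>S\<close>. Invariance of
  Lebesgue measure under \<open>L\<close> then carries numerator and denominator over. The same
  argument serves the symmetries and the translation to the reference point.\<close>

lemma distr_uniform_measure_transport:
  fixes V :: "'a \<Rightarrow> 'b :: euclidean_space"
  assumes [measurable]: "V \<in> borel_measurable M" "A \<in> sets borel"
    "L \<in> borel_measurable borel" "K \<in> borel_measurable borel"
    and V: "distr M lborel V = uniform_measure lborel A"
    and L: "distr lborel borel L = lborel" and inv: "\<And>v. K (L v) = v"
  shows "distr M lborel (\<lambda>\<omega>. L (V \<omega>)) = uniform_measure lborel (K -` A)"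
proof (rule measure_eqI)
  have KA: "K -` A \<in> sets borel"
    using measurable_sets[OF assms(4,2)] by simp
  have push: "emeasure lborel (L -` S) = emeasure lborel S" if [measurable]: "S \<in> sets borel" for S
  proof -
    have "emeasure lborel S = emeasure (distr lborel borel L) S" by (simp add: L)
    also have "\<dots> = emeasure lborel (L -` S)" by (subst emeasure_distr) auto
    finally show ?thesis by simp
  qed
  fix S assume "S \<in> sets (distr M lborel (\<lambda>\<omega>. L (V \<omega>)))"
  then have S [measurable]: "S \<in> sets borel" by simp
  have LS: "L -` S \<in> sets borel"
    using measurable_sets[OF assms(3) S] by simp
  have "emeasure (distr M lborel (\<lambda>\<omega>. L (V \<omega>))) S = emeasure M (V -` (L -` S) \<inter> space M)"
    by (subst emeasure_distr) (auto intro!: arg_cong[where f = "emeasure M"])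
  also have "\<dots> = emeasure (distr M lborel V) (L -` S)"
    using LS by (subst emeasure_distr) auto
  also have "\<dots> = emeasure lborel (A \<inter> L -` S) / emeasure lborel A"
    using LS by (simp add: V)
  also have "A \<inter> L -` S = L -` (K -` A \<inter> S)" by (auto simp: inv)
  also have "emeasure lborel \<dots> = emeasure lborel (K -` A \<inter> S)"
    using KA by (intro push) auto
  also have "emeasure lborel A = emeasure lborel (K -` A)"
    using push[OF KA] by (simp add: vimage_def inv)
  finally show "emeasure (distr M lborel (\<lambda>\<omega>. L (V \<omega>))) S = emeasure (uniform_measure lborel (K -` A)) S"
    using KA by simp
qed simp

text \<open>The box is described by the distances from the origin to its right, left, upper and
  lower sides, so that a symmetry merely permutes the four parameters.\<close>

definition uniform_on_box :: "'a measure \<Rightarrow> ('a \<Rightarrow> real \<times> real) \<Rightarrow> real \<Rightarrow> real \<Rightarrow> real \<Rightarrow> real \<Rightarrow> bool" where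
  "uniform_on_box M W h h' k k' \<longleftrightarrow>
     W \<in> borel_measurable M \<and> distr M lborel W = uniform_measure lborel ({- h'..h} \<times> {- k'..k})"

lemma box_measurable: "{a..b} \<times> {c..d} \<in> sets (borel :: (real \<times> real) measure)"
  by (intro borel_closed closed_Times) auto

lemma uniform_on_box_swap:
  assumes "uniform_on_box M W h h' k k'"
  shows "uniform_on_box M (\<lambda>\<omega>. (snd (W \<omega>), fst (W \<omega>))) k k' h h'"
proof -
  have W: "W \<in> borel_measurable M" using assms by (simp add: uniform_on_box_def)
  have L: "(\<lambda>v :: real \<times> real. (snd v, fst v)) \<in> borel_measurable borel"
    by (intro borel_measurable_continuous_onI continuous_intros)
  have "distr M lborel (\<lambda>\<omega>. (snd (W \<omega>), fst (W \<omega>))) =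
     uniform_measure lborel ((\<lambda>v. (snd v, fst v)) -` ({- h'..h} \<times> {- k'..k}))"
    using assms L unfolding uniform_on_box_def
    by (intro distr_uniform_measure_transport[where L="\<lambda>v. (snd v, fst v)"] box_measurable lborel_distr_swap) auto
  moreover have "(\<lambda>v. (snd v, fst v)) -` ({- h'..h} \<times> {- k'..k}) = {- k'..k} \<times> {- h'..h}" by auto
  moreover have "(\<lambda>\<omega>. (snd (W \<omega>), fst (W \<omega>))) \<in> borel_measurable M"
    by (rule measurable_compose[OF W L])
  ultimately show ?thesis by (simp add: uniform_on_box_def)
qed

lemma uniform_on_box_reflect_fst:
  assumes "uniform_on_box M W h h' k k'"
  shows "uniform_on_box M (\<lambda>\<omega>. (- fst (W \<omega>), snd (W \<omega>))) h' h k k'"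
proof -
  have W: "W \<in> borel_measurable M" using assms by (simp add: uniform_on_box_def)
  have L: "(\<lambda>v :: real \<times> real. (- fst v, snd v)) \<in> borel_measurable borel"
    by (intro borel_measurable_continuous_onI continuous_intros)
  have "distr M lborel (\<lambda>\<omega>. (- fst (W \<omega>), snd (W \<omega>))) =
     uniform_measure lborel ((\<lambda>v. (- fst v, snd v)) -` ({- h'..h} \<times> {- k'..k}))"
    using assms L unfolding uniform_on_box_def
    by (intro distr_uniform_measure_transport[where L="\<lambda>v. (- fst v, snd v)"] box_measurable lborel_distr_reflect) auto
  moreover have "(\<lambda>v. (- fst v, snd v)) -` ({- h'..h} \<times> {- k'..k}) = {- h..h'} \<times> {- k'..k}" by auto
  moreover have "(\<lambda>\<omega>. (- fst (W \<omega>), snd (W \<omega>))) \<in> borel_measurable M"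
    by (rule measurable_compose[OF W L])
  ultimately show ?thesis by (simp add: uniform_on_box_def)
qed

text \<open>Conjugating the reflection of the first coordinate by the swap reflects the
  second.\<close>

lemma uniform_on_box_reflect_snd:
  assumes "uniform_on_box M W h h' k k'"
  shows "uniform_on_box M (\<lambda>\<omega>. (fst (W \<omega>), - snd (W \<omega>))) h h' k' k"
  using uniform_on_box_swap[OF uniform_on_box_reflect_fst[OF uniform_on_box_swap[OF assms]]] by simp

lemma uniform_on_box_AE_null:
  assumes "uniform_on_box M W h h' k k'" "N \<in> null_sets lborel"
  shows "AE \<omega> in M. W \<omega> \<notin> N"
proof (rule AE_I)
  have W [measurable]: "W \<in> borel_measurable M" using assms by (simp add: uniform_on_box_def)
  have N [measurable]: "N \<in> sets borel" using assms by auto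
  show "W -` N \<inter> space M \<in> sets M" using measurable_sets[OF W N] .
  have "emeasure M (W -` N \<inter> space M) = emeasure (distr M lborel W) N"
    by (subst emeasure_distr) auto
  also have "\<dots> = emeasure lborel (({- h'..h} \<times> {- k'..k}) \<inter> N) / emeasure lborel ({- h'..h} \<times> {- k'..k})"
    using assms(1) box_measurable[of "- h'" h "- k'" k] by (simp add: uniform_on_box_def)
  also have "emeasure lborel (({- h'..h} \<times> {- k'..k}) \<inter> N) = 0"
    using null_set_Int1[OF assms(2), of "{- h'..h} \<times> {- k'..k}"] box_measurable
    by (auto simp: Int_commute null_setsD1)
  finally show "emeasure M (W -` N \<inter> space M) = 0" by simp
qed auto

section \<open>Azimuth events and their probabilities\<close>

text \<open>The line through the origin with direction angle \<open>c\<close>, written without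
  division so that vertical lines are included; its normal \<open>(- sin c, cos c)\<close> is never
  zero.\<close>

lemma null_sets_line: "{v :: real \<times> real. cos c * snd v = sin c * fst v} \<in> null_sets lborel"
proof -
  have "negligible {v :: real \<times> real. (- sin c, cos c) \<bullet> v = 0}"
    by (intro negligible_hyperplane) (auto simp: zero_prod_def dest: sin_zero_abs_cos_one)
  also have "{v :: real \<times> real. (- sin c, cos c) \<bullet> v = 0} = {v. cos c * snd v = sin c * fst v}"
    by (auto simp: inner_prod_def)
  finally have "{v. cos c * snd v = sin c * fst v} \<in> null_sets (completion lborel)"
    by (simp add: negligible_iff_null_sets)
  \<comment> \<open>Negligibility only gives a null set of the completed measure; Borel
    measurability brings it back to \<open>lborel\<close>.\<close>
  moreover have "{v :: real \<times> real. cos c * snd v = sin c * fst v} \<in> sets lborel"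
    by (simp, intro borel_closed closed_Collect_eq continuous_intros)
  ultimately show ?thesis by (simp add: null_sets_completion_iff)
qed

text \<open>Both \<open>R \<omega> = 0\<close> and \<open>X \<omega> = c\<close> put
  \<open>W \<omega>\<close> on the line with direction angle \<open>c\<close>.\<close>

lemma uniform_on_box_AE_azimuth:
  assumes "uniform_on_box M W h h' k k'"
    and "\<And>\<omega>. \<omega> \<in> space M \<Longrightarrow> W \<omega> = (R \<omega> * cos (X \<omega>), R \<omega> * sin (X \<omega>))"
  shows "AE \<omega> in M. R \<omega> \<noteq> 0 \<and> X \<omega> \<noteq> c"
  using uniform_on_box_AE_null[OF assms(1) null_sets_line[of c]]
  by (rule AE_mp) (auto simp: assms(2))

text \<open>The interval from \<open>- 3 * pi / 2\<close> to \<open>2 * pi\<close> is the largest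
  one around 0 in which sine and cosine are both positive only on the open first quadrant. It
  contains \<open>\<Theta> - \<beta>\<close> and \<open>\<beta> - \<Theta>\<close> for every
  half-axis direction \<open>\<beta>\<close> used below.\<close>

lemma sector_angle_iff:
  fixes x \<phi> :: real
  assumes "- (3 * pi / 2) \<le> x" "x \<le> 2 * pi" "0 \<le> \<phi>" "\<phi> < pi / 2"
  shows "0 < cos x \<and> 0 < sin x \<and> sin x \<le> tan \<phi> * cos x \<longleftrightarrow> 0 < x \<and> x \<le> \<phi>"
proof (cases "0 < x \<and> x < pi / 2")
  case True
  then have "0 < cos x" "0 < sin x" by (auto intro: cos_gt_zero sin_gt_zero)
  moreover have "sin x \<le> tan \<phi> * cos x \<longleftrightarrow> tan x \<le> tan \<phi>"
    using \<open>0 < cos x\<close> by (simp add: tan_def pos_divide_le_eq)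
  moreover have "tan x \<le> tan \<phi> \<longleftrightarrow> x \<le> \<phi>"
    using True assms by (intro tan_mono_le_eq) auto
  ultimately show ?thesis using True by auto
next
  case False
  have cos_neg: "cos y \<le> 0" if "pi / 2 \<le> y" "y \<le> 3 * pi / 2" for y
    using cos_ge_zero[of "y - pi"] that by simp
  have sin_neg: "sin y \<le> 0" if "pi \<le> y" "y \<le> 2 * pi" for y
    using sin_ge_zero[of "y - pi"] that by simp
  consider "x \<le> - pi / 2" | "- pi / 2 < x" "x \<le> 0" | "pi / 2 \<le> x" "x \<le> 3 * pi / 2" | "3 * pi / 2 < x"
    using False by linarith
  then have "cos x \<le> 0 \<or> sin x \<le> 0"
  proof cases
    case 1 then show ?thesis using cos_neg[of "- x"] assms by simp
  next
    case 2 then show ?thesis using sin_ge_zero[of "- x"] by simp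
  next
    case 3 then show ?thesis using cos_neg by simp
  next
    case 4 then show ?thesis using sin_neg[of x] assms by simp
  qed
  then show ?thesis using False assms by auto
qed

text \<open>Up to a null set the event says that \<open>W\<close> lies in a sector. The bound on
  \<open>\<phi>\<close> keeps this sector inside the box, so its probability is a quotient of areas.
  The angle \<open>X\<close> is kept general because it will be an azimuth measured from some
  half-axis in either orientation.\<close>

lemma prob_sector:
  assumes "prob_space M" and unif: "uniform_on_box M W h h' k k'"
    and box: "0 < h" "0 < k" "0 \<le> h'" "0 \<le> k'"
    and [measurable]: "R \<in> borel_measurable M" "X \<in> borel_measurable M"
    and R: "\<And>\<omega>. \<omega> \<in> space M \<Longrightarrow> 0 \<le> R \<omega>"
    and X: "\<And>\<omega>. \<omega> \<in> space M \<Longrightarrow> - (3 * pi / 2) \<le> X \<omega> \<and> X \<omega> \<le> 2 * pi"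
    and W: "\<And>\<omega>. \<omega> \<in> space M \<Longrightarrow> W \<omega> = (R \<omega> * cos (X \<omega>), R \<omega> * sin (X \<omega>))"
    and "0 < r" and \<phi>: "0 \<le> \<phi>" "\<phi> \<le> arctan (k / h)"
  shows "\<P>(\<omega> in M. R \<omega> \<le> r \<and> 0 < X \<omega> \<and> X \<omega> \<le> \<phi>) = sector_area h r \<phi> / ((h + h') * (k + k'))"
proof -
  interpret prob_space M by fact
  let ?B = "{- h'..h} \<times> {- k'..k}" and ?S = "sector h r (tan \<phi>)"
  have [measurable]: "W \<in> borel_measurable M" and dist: "distr M lborel W = uniform_measure lborel ?B"
    using unif by (auto simp: uniform_on_box_def)
  have \<phi>2: "\<phi> < pi / 2" using \<phi> arctan_ubound[of "k / h"] by linarith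
  \<comment> \<open>At \<open>p = h\<close> the line of slope \<open>tan \<phi>\<close> is at height
    at most \<open>k\<close>, which is where the corner angle enters.\<close>
  have sub: "?S \<subseteq> ?B"
  proof
    fix v assume "v \<in> ?S"
    then obtain p q where v: "v = (p, q)" "0 < p" "p \<le> h" "0 < q" "q \<le> tan \<phi> * p" by (auto simp: sector_def)
    have "tan \<phi> \<le> tan (arctan (k / h))"
      using \<phi> \<phi>2 arctan_ubound[of "k / h"] by (subst tan_mono_le_eq) linarith+
    then have "tan \<phi> * p \<le> k / h * h"
      using v box by (intro mult_mono) (auto simp: tan_arctan)
    then show "v \<in> ?B" using v box by auto
  qed
  have eB: "emeasure lborel ?B = ennreal ((h + h') * (k + k'))"
    using box by (simp add: lborel_prod[symmetric] lborel.emeasure_pair_measure_Times ennreal_mult'')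
  have "AE \<omega> in M. W \<omega> \<in> ?B"
  proof -
    have "AE v in distr M lborel W. v \<in> ?B"
      unfolding dist using box_measurable eB box
      by (intro AE_uniform_measureI) auto
    then show ?thesis using box_measurable by (subst (asm) AE_distr_iff) auto
  qed
  moreover have "AE \<omega> in M. R \<omega> \<noteq> 0 \<and> X \<omega> \<noteq> 0"
    by (rule uniform_on_box_AE_azimuth[OF unif W])
  \<comment> \<open>Away from \<open>R \<omega> = 0\<close> the common factor
    \<open>R \<omega>\<close> cancels, leaving conditions on the angle alone.\<close>
  ultimately have ae: "AE \<omega> in M. (R \<omega> \<le> r \<and> 0 < X \<omega> \<and> X \<omega> \<le> \<phi>) \<longleftrightarrow> W \<omega> \<in> ?S"
    using AE_space
  proof eventually_elim
    case (elim \<omega>)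
    then have pos: "0 < R \<omega>" using R[of \<omega>] by simp
    have "(R \<omega> * cos (X \<omega>))\<^sup>2 + (R \<omega> * sin (X \<omega>))\<^sup>2 = (R \<omega>)\<^sup>2 * ((cos (X \<omega>))\<^sup>2 + (sin (X \<omega>))\<^sup>2)"
      by (simp only: power_mult_distrib distrib_left)
    then have "W \<omega> \<in> ?S \<longleftrightarrow> (R \<omega>)\<^sup>2 \<le> r\<^sup>2 \<and>
        (0 < cos (X \<omega>) \<and> 0 < sin (X \<omega>) \<and> R \<omega> * sin (X \<omega>) \<le> R \<omega> * (tan \<phi> * cos (X \<omega>)))"
      using elim W[of \<omega>] pos by (auto simp: sector_def zero_less_mult_iff mult_ac)
    also have "\<dots> \<longleftrightarrow> R \<omega> \<le> r \<and> (0 < cos (X \<omega>) \<and> 0 < sin (X \<omega>) \<and> sin (X \<omega>) \<le> tan \<phi> * cos (X \<omega>))"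
      using pos \<open>0 < r\<close> by (simp add: power_mono_iff)
    also have "\<dots> \<longleftrightarrow> R \<omega> \<le> r \<and> 0 < X \<omega> \<and> X \<omega> \<le> \<phi>"
      using elim X[of \<omega>] \<phi> \<phi>2 by (subst sector_angle_iff) auto
    finally show ?case by simp
  qed
  have "\<P>(\<omega> in M. R \<omega> \<le> r \<and> 0 < X \<omega> \<and> X \<omega> \<le> \<phi>) = measure M (W -` ?S \<inter> space M)"
    by (rule measure_eq_AE) (use ae in auto)
  also have "\<dots> = measure (distr M lborel W) ?S"
    by (subst measure_distr) auto
  also have "\<dots> = measure lborel (?B \<inter> ?S) / measure lborel ?B"
    unfolding dist using eB box by (intro measure_uniform_measure) auto
  also have "?B \<inter> ?S = ?S" using sub by auto
  also have "measure lborel ?S = sector_area h r \<phi>"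
    using box \<open>0 < r\<close> \<phi> \<phi>2 by (intro measure_sector)
  also have "measure lborel ?B = (h + h') * (k + k')"
    using eB box by (simp add: measure_def)
  finally show ?thesis .
qed

section \<open>The summands of the formula\<close>

text \<open>
  With \<open>f\<close> either \<open>tan\<close> or \<open>- cot\<close> and with the entries of \<^const>\<open>chi_less\<close>,
  \<^const>\<open>chi_ge\<close> and \<^const>\<open>mu\<close> as \<open>cl\<close>, \<open>cg\<close> and \<open>m\<close>, this is the contribution
  of one index \<open>i\<close> to the formula, scaled by the area of the rectangle.
\<close>

definition wedge_term :: "(real \<Rightarrow> real) \<Rightarrow> real \<Rightarrow> real \<Rightarrow> real \<Rightarrow> real \<times> real \<Rightarrow> real \<times> real \<Rightarrow> real \<times> real \<Rightarrow> real" where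
  "wedge_term f h r \<theta> cl cg m =
     r\<^sup>2 / 2 * (of_bool (r < h) * pos_part (min \<theta> (snd cl) - fst cl)
       + of_bool (r \<ge> h) * pos_part (min \<theta> (snd cg) - fst cg))
     + h\<^sup>2 / 2 * of_bool (r \<ge> h) * incr f (fst m) (min \<theta> (snd m))"

text \<open>A wedge that starts at the half-axis \<open>\<beta>\<close> and ends at a corner ray.
  The angle swept up to \<open>\<theta>\<close> is \<open>\<theta> - \<beta>\<close> clamped to the
  range from 0 to \<open>\<phi>\<close>.\<close>

lemma wedge_term_ccw:
  assumes "0 < h" "0 < r" "0 \<le> \<phi>" and f: "\<And>x. f (\<beta> + x) = tan x"
  defines "\<alpha> \<equiv> arccos (h / r)"
  shows "wedge_term f h r \<theta> (\<beta>, \<beta> + \<phi>) (\<beta> + \<alpha>, \<beta> + \<phi>) (\<beta>, \<beta> + min \<alpha> \<phi>)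
    = sector_area h r (max 0 (min \<phi> (\<theta> - \<beta>)))"
proof (cases "r < h")
  case True
  then show ?thesis using assms(3) by (auto simp: wedge_term_def sector_area_def pos_part_def min_def max_def)
next
  case False
  then have hr: "0 < h / r" "h / r \<le> 1" using assms by auto
  have \<alpha>: "0 \<le> \<alpha>" unfolding \<alpha>_def using hr by (intro arccos_lbound) linarith+
  define c where "c = max 0 (min \<phi> (\<theta> - \<beta>))"
  have f': "f y = tan (y - \<beta>)" for y using f[of "y - \<beta>"] by simp
  \<comment> \<open>Before the half-axis is reached, \<open>incr\<close> is 0 by its second branch,
    in agreement with \<open>tan 0\<close>.\<close>
  have "incr f \<beta> (min \<theta> (\<beta> + min \<alpha> \<phi>)) = tan (min c \<alpha>)"
  proof (cases "\<theta> < \<beta>")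
    case True
    then have "min \<theta> (\<beta> + min \<alpha> \<phi>) < \<beta>" "min c \<alpha> = 0" using \<alpha> by (auto simp: c_def)
    then show ?thesis by (metis incr_def not_le tan_zero)
  next
    case False
    then have "min \<theta> (\<beta> + min \<alpha> \<phi>) = \<beta> + min c \<alpha>" "min c \<alpha> \<ge> 0"
      using \<alpha> assms(3) by (auto simp: c_def min_def max_def)
    then show ?thesis by (simp add: incr_def f')
  qed
  moreover have "pos_part (min \<theta> (\<beta> + \<phi>) - (\<beta> + \<alpha>)) = max 0 (c - \<alpha>)"
    using \<alpha> assms(3) by (auto simp: c_def pos_part_def min_def max_def)
  ultimately show ?thesis
    using False by (simp add: wedge_term_def sector_area_def c_def[symmetric] \<alpha>_def[symmetric])
qed

text \<open>Here the sweep starts at the corner ray and ends at the half-axis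
  \<open>\<beta>\<close>. What is covered is the whole wedge minus the part of angle
  \<open>c\<close> next to the half-axis that is still ahead, hence a difference of two
  areas.\<close>

lemma wedge_term_cw:
  assumes "0 < h" "0 < r" "0 \<le> \<phi>" and f: "\<And>x. f (\<beta> - x) = - tan x"
  defines "\<alpha> \<equiv> arccos (h / r)"
  shows "wedge_term f h r \<theta> (\<beta> - \<phi>, \<beta>) (\<beta> - \<phi>, \<beta> - \<alpha>) (\<beta> - min \<alpha> \<phi>, \<beta>)
    = sector_area h r \<phi> - sector_area h r (max 0 (min \<phi> (\<beta> - \<theta>)))"
proof (cases "r < h")
  case True
  have "pos_part (min \<theta> \<beta> - (\<beta> - \<phi>)) = \<phi> - max 0 (min \<phi> (\<beta> - \<theta>))"
    using assms(3) by (auto simp: pos_part_def min_def max_def)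
  with True show ?thesis by (simp add: wedge_term_def sector_area_def right_diff_distrib)
next
  case False
  then have hr: "0 < h / r" "h / r \<le> 1" using assms by auto
  have \<alpha>: "0 \<le> \<alpha>" unfolding \<alpha>_def using hr by (intro arccos_lbound) linarith+
  define c where "c = max 0 (min \<phi> (\<beta> - \<theta>))"
  have f': "f y = - tan (\<beta> - y)" for y using f[of "\<beta> - y"] by simp
  \<comment> \<open>If \<open>\<theta>\<close> has not reached the triangular part, then
    \<open>c\<close> is at least \<open>min \<alpha> \<phi>\<close> and both tangents
    coincide.\<close>
  have "incr f (\<beta> - min \<alpha> \<phi>) (min \<theta> \<beta>) = tan (min \<phi> \<alpha>) - tan (min c \<alpha>)"
  proof (cases "min \<theta> \<beta> < \<beta> - min \<alpha> \<phi>")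
    case True
    then have "min c \<alpha> = min \<phi> \<alpha>" using \<alpha> assms(3) by (auto simp: c_def min_def max_def split: if_splits)
    with True show ?thesis by (metis incr_def not_le diff_self)
  next
    case False
    then have "min \<theta> \<beta> = \<beta> - min c \<alpha>"
      using \<alpha> assms(3) by (auto simp: c_def min_def max_def split: if_splits)
    moreover have "incr f (\<beta> - min \<alpha> \<phi>) (min \<theta> \<beta>) = f (min \<theta> \<beta>) - f (\<beta> - min \<alpha> \<phi>)"
      using False by (simp only: incr_def not_less if_True)
    ultimately show ?thesis by (simp only: f') (simp add: min.commute)
  qed
  moreover have "pos_part (min \<theta> (\<beta> - \<alpha>) - (\<beta> - \<phi>)) = max 0 (\<phi> - \<alpha>) - max 0 (c - \<alpha>)"
    using \<alpha> assms(3) by (auto simp: c_def pos_part_def min_def max_def)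
  ultimately show ?thesis
    using False by (simp add: wedge_term_def sector_area_def c_def[symmetric] \<alpha>_def[symmetric]
      right_diff_distrib diff_divide_distrib)
qed

text \<open>
  For \<open>r < h\<close> the inverse cosines and sines in \<^const>\<open>chi_ge\<close> and \<^const>\<open>mu\<close> are junk, so
  identities between them are only available under \<open>h \<le> r\<close>.
\<close>

lemma wedge_term_cong:
  assumes "h \<le> r \<Longrightarrow> cg = cg'" "h \<le> r \<Longrightarrow> m = m'"
  shows "wedge_term f h r \<theta> cl cg m = wedge_term f h r \<theta> cl cg' m'"
  using assms by (cases "h \<le> r") (auto simp: wedge_term_def)

section \<open>Increments of the distribution function over the wedges\<close>

text \<open>\<open>W\<close> is the position relative to the reference point. The radius
  \<open>r\<close> is fixed, so that \<open>cdf\<close> is a function of the angle alone and the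
  formula can be read as a telescoping sum.\<close>

locale polar_rectangle = prob_space M for M :: "'a measure" +
  fixes W :: "'a \<Rightarrow> real \<times> real" and R \<Theta> :: "'a \<Rightarrow> real" and xp xm yp ym r :: real
  assumes uniform: "uniform_on_box M W xp (- xm) yp (- ym)"
    and pos: "0 < xp" "xm < 0" "0 < yp" "ym < 0" "0 < r"
    and R_meas [measurable]: "R \<in> borel_measurable M"
    and \<Theta>_meas [measurable]: "\<Theta> \<in> borel_measurable M"
    and R_nonneg: "\<And>\<omega>. \<omega> \<in> space M \<Longrightarrow> 0 \<le> R \<omega>"
    and \<Theta>_range: "\<And>\<omega>. \<omega> \<in> space M \<Longrightarrow> 0 \<le> \<Theta> \<omega> \<and> \<Theta> \<omega> < 2 * pi"
    and polar: "\<And>\<omega>. \<omega> \<in> space M \<Longrightarrow> W \<omega> = (R \<omega> * cos (\<Theta> \<omega>), R \<omega> * sin (\<Theta> \<omega>))"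
begin

definition cdf :: "real \<Rightarrow> real" where
  "cdf \<theta> = \<P>(\<omega> in M. R \<omega> \<le> r \<and> \<Theta> \<omega> \<le> \<theta>)"

lemma cdf_diff:
  assumes "s \<le> t"
  shows "cdf t - cdf s = \<P>(\<omega> in M. R \<omega> \<le> r \<and> s < \<Theta> \<omega> \<and> \<Theta> \<omega> \<le> t)"
proof -
  have "\<P>(\<omega> in M. R \<omega> \<le> r \<and> s < \<Theta> \<omega> \<and> \<Theta> \<omega> \<le> t)
    = prob ({\<omega> \<in> space M. R \<omega> \<le> r \<and> \<Theta> \<omega> \<le> t} - {\<omega> \<in> space M. R \<omega> \<le> r \<and> \<Theta> \<omega> \<le> s})"
    by (intro arg_cong[where f = prob]) auto
  also have "\<dots> = cdf t - cdf s"
    unfolding cdf_def using assms by (intro finite_measure_Diff) auto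
  finally show ?thesis by simp
qed

lemma azimuth_neq_AE: "AE \<omega> in M. \<Theta> \<omega> \<noteq> c"
  using uniform_on_box_AE_azimuth[OF uniform polar, where c = c] by (rule AE_mp) auto

lemma cdf_0: "cdf 0 = 0"
proof -
  have "AE \<omega> in M. \<not> \<Theta> \<omega> \<le> 0"
    using azimuth_neq_AE[of 0] AE_space by eventually_elim (use \<Theta>_range in force)
  then have "cdf 0 = prob {}"
    unfolding cdf_def by (intro measure_eq_AE) auto
  then show ?thesis by simp
qed

text \<open>For \<open>\<theta> < s\<close> both sides vanish; otherwise the maximum has no effect
  and \<open>min \<theta> s\<close> is \<open>s\<close>.\<close>

lemma cdf_clamp:
  assumes "s \<le> t"
  shows "cdf (min \<theta> t) - cdf (min \<theta> s) = cdf (max s (min \<theta> t)) - cdf s"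
  using assms by (auto simp: min_def max_def)

text \<open>\<open>Z\<close> is the image of \<open>W\<close> under a rotation that takes the
  half-axis \<open>\<beta>\<close> to the positive first axis, so its azimuth is
  \<open>\<Theta> - \<beta>\<close> and the corner sits at \<open>arctan (k / h)\<close>. The
  distances \<open>h'\<close> and \<open>k'\<close> enter only through the area of the box.\<close>

lemma cdf_wedge_ccw:
  assumes Z: "uniform_on_box M Z h h' k k'"
    and Z_polar: "\<And>\<omega>. \<omega> \<in> space M \<Longrightarrow> Z \<omega> = (R \<omega> * cos (\<Theta> \<omega> - \<beta>), R \<omega> * sin (\<Theta> \<omega> - \<beta>))"
    and "0 < h" "0 < k" "0 < h'" "0 < k'" and "0 \<le> \<beta>" "\<beta> \<le> 3 * pi / 2"
    and f: "\<And>x. f (\<beta> + x) = tan x"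
    and \<phi>: "\<phi> = arctan (k / h)" and \<alpha>: "\<alpha> = arccos (h / r)"
    and t: "t = \<beta> + \<phi>"
    and cg: "h \<le> r \<Longrightarrow> cg = (\<beta> + \<alpha>, t)" and m: "h \<le> r \<Longrightarrow> m = (\<beta>, min (\<beta> + \<alpha>) t)"
  shows "wedge_term f h r \<theta> (\<beta>, t) cg m = (h + h') * (k + k') * (cdf (min \<theta> t) - cdf (min \<theta> \<beta>))"
proof -
  define c where "c = max 0 (min \<phi> (\<theta> - \<beta>))"
  have \<phi>0: "0 \<le> \<phi>" using assms by (simp add: \<phi>)
  have "cdf (min \<theta> t) - cdf (min \<theta> \<beta>) = cdf (\<beta> + c) - cdf \<beta>"
  proof -
    have "max \<beta> (min \<theta> t) = \<beta> + c" using \<phi>0 by (auto simp: t c_def min_def max_def)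
    then show ?thesis using \<phi>0 by (simp add: cdf_clamp t)
  qed
  also have "\<dots> = \<P>(\<omega> in M. R \<omega> \<le> r \<and> 0 < \<Theta> \<omega> - \<beta> \<and> \<Theta> \<omega> - \<beta> \<le> c)"
    by (subst cdf_diff) (auto simp: c_def algebra_simps)
  also have "\<dots> = sector_area h r c / ((h + h') * (k + k'))"
  proof (rule prob_sector[OF prob_space_axioms Z])
    fix \<omega> assume "\<omega> \<in> space M"
    then show "- (3 * pi / 2) \<le> \<Theta> \<omega> - \<beta> \<and> \<Theta> \<omega> - \<beta> \<le> 2 * pi"
      using \<Theta>_range[of \<omega>] assms by auto
  qed (use assms pos \<phi>0 R_nonneg in \<open>auto simp: c_def\<close>)
  finally have "(h + h') * (k + k') * (cdf (min \<theta> t) - cdf (min \<theta> \<beta>)) = sector_area h r c"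
    using assms by simp
  also have "\<dots> = wedge_term f h r \<theta> (\<beta>, \<beta> + \<phi>) (\<beta> + \<alpha>, \<beta> + \<phi>) (\<beta>, \<beta> + min \<alpha> \<phi>)"
    unfolding \<alpha> c_def using assms pos \<phi>0 by (intro wedge_term_ccw[symmetric])
  also have "\<dots> = wedge_term f h r \<theta> (\<beta>, t) cg m"
    unfolding t by (intro wedge_term_cong) (simp_all add: cg m t min_add_distrib_right)
  finally show ?thesis by simp
qed

text \<open>Same reduction with a reflection, which turns the azimuth into
  \<open>\<beta> - \<Theta>\<close>. The sector lemma then measures angles backwards from the
  half-axis, so the increment is a difference of two such areas.\<close>

lemma cdf_wedge_cw:
  assumes Z: "uniform_on_box M Z h h' k k'"
    and Z_polar: "\<And>\<omega>. \<omega> \<in> space M \<Longrightarrow> Z \<omega> = (R \<omega> * cos (\<beta> - \<Theta> \<omega>), R \<omega> * sin (\<beta> - \<Theta> \<omega>))"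
    and "0 < h" "0 < k" "0 < h'" "0 < k'" and "pi / 2 \<le> \<beta>" "\<beta> \<le> 2 * pi"
    and f: "\<And>x. f (\<beta> - x) = - tan x"
    and \<phi>: "\<phi> = arctan (k / h)" and \<alpha>: "\<alpha> = arccos (h / r)"
    and t: "t = \<beta> - \<phi>"
    and cg: "h \<le> r \<Longrightarrow> cg = (t, \<beta> - \<alpha>)" and m: "h \<le> r \<Longrightarrow> m = (max t (\<beta> - \<alpha>), \<beta>)"
  shows "wedge_term f h r \<theta> (t, \<beta>) cg m = (h + h') * (k + k') * (cdf (min \<theta> \<beta>) - cdf (min \<theta> t))"
proof -
  have \<phi>0: "0 \<le> \<phi>" using assms by (simp add: \<phi>)
  have area: "cdf \<beta> - cdf (\<beta> - c) = sector_area h r c / ((h + h') * (k + k'))" if "0 \<le> c" "c \<le> \<phi>" for c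
  proof -
    have "cdf \<beta> - cdf (\<beta> - c) = \<P>(\<omega> in M. R \<omega> \<le> r \<and> \<beta> - c < \<Theta> \<omega> \<and> \<Theta> \<omega> \<le> \<beta>)"
      using that by (subst cdf_diff) auto
    also have "\<dots> = \<P>(\<omega> in M. R \<omega> \<le> r \<and> 0 < \<beta> - \<Theta> \<omega> \<and> \<beta> - \<Theta> \<omega> \<le> c)"
    \<comment> \<open>Reversing the orientation moves the closed end of the half-open range; the two
      events differ only on the rays at \<open>\<beta>\<close> and \<open>\<beta> - c\<close>, which
      have probability 0.\<close>
    proof (rule measure_eq_AE)
      show "AE \<omega> in M. \<omega> \<in> {\<omega> \<in> space M. R \<omega> \<le> r \<and> \<beta> - c < \<Theta> \<omega> \<and> \<Theta> \<omega> \<le> \<beta>}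
          \<longleftrightarrow> \<omega> \<in> {\<omega> \<in> space M. R \<omega> \<le> r \<and> 0 < \<beta> - \<Theta> \<omega> \<and> \<beta> - \<Theta> \<omega> \<le> c}"
        using azimuth_neq_AE[of \<beta>] azimuth_neq_AE[of "\<beta> - c"] by eventually_elim auto
    qed auto
    also have "\<dots> = sector_area h r c / ((h + h') * (k + k'))"
    proof (rule prob_sector[OF prob_space_axioms Z])
      fix \<omega> assume "\<omega> \<in> space M"
      then show "- (3 * pi / 2) \<le> \<beta> - \<Theta> \<omega> \<and> \<beta> - \<Theta> \<omega> \<le> 2 * pi"
        using \<Theta>_range[of \<omega>] assms by auto
    qed (use assms pos that R_nonneg in auto)
    finally show ?thesis .
  qed
  define c where "c = max 0 (min \<phi> (\<beta> - \<theta>))"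
  have "cdf (min \<theta> \<beta>) - cdf (min \<theta> t) = cdf (\<beta> - c) - cdf (\<beta> - \<phi>)"
  proof -
    have "max t (min \<theta> \<beta>) = \<beta> - c" using \<phi>0 by (auto simp: t c_def min_def max_def)
    then show ?thesis using \<phi>0 by (simp add: cdf_clamp t)
  qed
  also have "\<dots> = (sector_area h r \<phi> - sector_area h r c) / ((h + h') * (k + k'))"
    using area[of \<phi>] area[of c] \<phi>0 by (simp add: c_def diff_divide_distrib)
  finally have "(h + h') * (k + k') * (cdf (min \<theta> \<beta>) - cdf (min \<theta> t)) = sector_area h r \<phi> - sector_area h r c"
    using assms by simp
  also have "\<dots> = wedge_term f h r \<theta> (\<beta> - \<phi>, \<beta>) (\<beta> - \<phi>, \<beta> - \<alpha>) (\<beta> - min \<alpha> \<phi>, \<beta>)"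
    unfolding \<alpha> c_def using assms pos \<phi>0 by (intro wedge_term_cw[symmetric])
  also have "\<dots> = wedge_term f h r \<theta> (t, \<beta>) cg m"
    unfolding t by (intro wedge_term_cong) (auto simp: cg m t min_def max_def)
  finally show ?thesis by simp
qed

end

section \<open>The eight wedges of the rectangle\<close>

lemma arctan_quotient_flip: "0 < x \<Longrightarrow> 0 < y \<Longrightarrow> arctan (x / y) = pi / 2 - arctan (y / x)"
  using arctan_inverse[of "y / x"] by (simp add: inverse_eq_divide)

lemma arcsin_arccos: "- 1 \<le> x \<Longrightarrow> x \<le> 1 \<Longrightarrow> arcsin x = pi / 2 - arccos x"
  by (simp add: arccos_arcsin_eq)

lemma trig_three_half_pi: "cos (3 * pi / 2) = 0" "sin (3 * pi / 2) = - 1"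
  using cos_3over2_pi sin_3over2_pi by simp_all

context polar_rectangle
begin

text \<open>Together with the identity for wedge 1, these are the eight signed coordinate
  permutations, listed in the order of wedges 2 to 8.\<close>

lemma uniform_rotations:
  "uniform_on_box M (\<lambda>\<omega>. (fst (W \<omega>), - snd (W \<omega>))) xp (- xm) (- ym) yp"
  "uniform_on_box M (\<lambda>\<omega>. (- fst (W \<omega>), - snd (W \<omega>))) (- xm) xp (- ym) yp"
  "uniform_on_box M (\<lambda>\<omega>. (- fst (W \<omega>), snd (W \<omega>))) (- xm) xp yp (- ym)"
  "uniform_on_box M (\<lambda>\<omega>. (snd (W \<omega>), fst (W \<omega>))) yp (- ym) xp (- xm)"
  "uniform_on_box M (\<lambda>\<omega>. (snd (W \<omega>), - fst (W \<omega>))) yp (- ym) (- xm) xp"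
  "uniform_on_box M (\<lambda>\<omega>. (- snd (W \<omega>), - fst (W \<omega>))) (- ym) yp (- xm) xp"
  "uniform_on_box M (\<lambda>\<omega>. (- snd (W \<omega>), fst (W \<omega>))) (- ym) yp xp (- xm)"
proof -
  note swap = uniform_on_box_swap and fst = uniform_on_box_reflect_fst and snd = uniform_on_box_reflect_snd
  show 2: "uniform_on_box M (\<lambda>\<omega>. (fst (W \<omega>), - snd (W \<omega>))) xp (- xm) (- ym) yp"
    using snd[OF uniform] by simp
  show 3: "uniform_on_box M (\<lambda>\<omega>. (- fst (W \<omega>), - snd (W \<omega>))) (- xm) xp (- ym) yp"
    using fst[OF 2] by simp
  show 4: "uniform_on_box M (\<lambda>\<omega>. (- fst (W \<omega>), snd (W \<omega>))) (- xm) xp yp (- ym)"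
    using fst[OF uniform] by simp
  show "uniform_on_box M (\<lambda>\<omega>. (snd (W \<omega>), fst (W \<omega>))) yp (- ym) xp (- xm)"
    using swap[OF uniform] by simp
  show "uniform_on_box M (\<lambda>\<omega>. (snd (W \<omega>), - fst (W \<omega>))) yp (- ym) (- xm) xp"
    using swap[OF 4] by simp
  show "uniform_on_box M (\<lambda>\<omega>. (- snd (W \<omega>), - fst (W \<omega>))) (- ym) yp (- xm) xp"
    using swap[OF 3] by simp
  show "uniform_on_box M (\<lambda>\<omega>. (- snd (W \<omega>), fst (W \<omega>))) (- ym) yp xp (- xm)"
    using swap[OF 2] by simp
qed

text \<open>Wedges 1, 3, 6 and 8 run counterclockwise from their half-axis, the others clockwise. At
  the vertical half-axes \<open>- cot\<close> is \<open>tan\<close> shifted by an odd multiple of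
  \<open>pi / 2\<close>, so one pair of wedge lemmas covers both functions.\<close>

lemma wedge_term_eq_cdf_increment:
  fixes \<theta> :: real
  defines "g1 \<equiv> arctan (yp / xp)" and "g2 \<equiv> arctan (yp / xm) + pi"
    and "g3 \<equiv> arctan (ym / xm) + pi" and "g4 \<equiv> arctan (ym / xp) + 2 * pi"
    and "A \<equiv> (xp - xm) * (yp - ym)" and "D \<equiv> \<lambda>s t. cdf (min \<theta> t) - cdf (min \<theta> s)"
  shows
   "wedge_term tan xp r \<theta> (0, g1) (arccos (xp / r), g1) (0, min (arccos (xp / r)) g1) = A * D 0 g1" (is ?W1)
   "wedge_term tan xp r \<theta> (g4, 2 * pi) (g4, 2 * pi - arccos (xp / r)) (max (2 * pi - arccos (xp / r)) g4, 2 * pi)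
      = A * D g4 (2 * pi)" (is ?W2)
   "wedge_term tan (- xm) r \<theta> (pi, g3) (2 * pi - arccos (xm / r), g3) (pi, min (2 * pi - arccos (xm / r)) g3)
      = A * D pi g3" (is ?W3)
   "wedge_term tan (- xm) r \<theta> (g2, pi) (g2, arccos (xm / r)) (max g2 (arccos (xm / r)), pi) = A * D g2 pi" (is ?W4)
   "wedge_term (\<lambda>x. - cot x) yp r \<theta> (g1, pi / 2) (g1, arcsin (yp / r)) (max g1 (arcsin (yp / r)), pi / 2)
      = A * D g1 (pi / 2)" (is ?W5)
   "wedge_term (\<lambda>x. - cot x) yp r \<theta> (pi / 2, g2) (pi - arcsin (yp / r), g2) (pi / 2, min (pi - arcsin (yp / r)) g2)
      = A * D (pi / 2) g2" (is ?W6)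
   "wedge_term (\<lambda>x. - cot x) (- ym) r \<theta> (g3, 3 * pi / 2) (g3, pi - arcsin (ym / r))
        (max g3 (pi - arcsin (ym / r)), 3 * pi / 2) = A * D g3 (3 * pi / 2)" (is ?W7)
   "wedge_term (\<lambda>x. - cot x) (- ym) r \<theta> (3 * pi / 2, g4) (2 * pi + arcsin (ym / r), g4)
        (3 * pi / 2, min (2 * pi + arcsin (ym / r)) g4) = A * D (3 * pi / 2) g4" (is ?W8)
proof -
  have A: "A = (xp + - xm) * (yp + - ym)" "A = (xp + - xm) * (- ym + yp)"
    "A = (- xm + xp) * (- ym + yp)" "A = (- xm + xp) * (yp + - ym)"
    "A = (yp + - ym) * (xp + - xm)" "A = (yp + - ym) * (- xm + xp)"
    "A = (- ym + yp) * (- xm + xp)" "A = (- ym + yp) * (xp + - xm)"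
    by (simp_all add: A_def algebra_simps)
  \<comment> \<open>The offsets \<open>xm\<close> and \<open>ym\<close> are negative, while the
    wedge lemmas use positive distances. The inequalities keep the arguments within the domain of
    \<open>arccos\<close>.\<close>
  have acos: "- xm \<le> r \<Longrightarrow> arccos (xm / r) = pi - arccos (- xm / r)"
    "- ym \<le> r \<Longrightarrow> arccos (ym / r) = pi - arccos (- ym / r)"
    using pos arccos_minus[of "xm / r"] arccos_minus[of "ym / r"] by (auto simp: divide_le_eq le_divide_eq)
  have asin: "yp \<le> r \<Longrightarrow> arcsin (yp / r) = pi / 2 - arccos (yp / r)"
    "- ym \<le> r \<Longrightarrow> arcsin (ym / r) = arccos (- ym / r) - pi / 2"
    using pos acos(2) by (auto simp: arcsin_arccos divide_le_eq le_divide_eq)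
  note g = g1_def g2_def g3_def g4_def
  \<comment> \<open>At a vertical half-axis the two legs trade places, so the wedge angle is the
    complement of the one formed with the horizontal half-axis.\<close>
  have flip: "arctan (xp / yp) = pi / 2 - g1" "arctan (- xm / yp) = g2 - pi / 2"
    "arctan (- xm / - ym) = 3 * pi / 2 - g3" "arctan (xp / - ym) = g4 - 3 * pi / 2"
  proof -
    have "arctan (yp / - xm) = - arctan (yp / xm)" "arctan (- ym / - xm) = arctan (ym / xm)"
      "arctan (- ym / xp) = - arctan (ym / xp)"
      by (simp_all add: arctan_minus)
    then show "arctan (xp / yp) = pi / 2 - g1" "arctan (- xm / yp) = g2 - pi / 2"
      "arctan (- xm / - ym) = 3 * pi / 2 - g3" "arctan (xp / - ym) = g4 - 3 * pi / 2"
      unfolding g using pos arctan_quotient_flip[of xp yp] arctan_quotient_flip[of "- xm" yp]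
        arctan_quotient_flip[of "- xm" "- ym"] arctan_quotient_flip[of xp "- ym"]
      by linarith+
  qed
  note trig = tan_def cot_def cos_diff sin_diff cos_add sin_add trig_three_half_pi
  show ?W1 unfolding D_def A(1)
    by (rule cdf_wedge_ccw[OF uniform]) (use pos in \<open>auto simp: polar g\<close>)
  show ?W2 unfolding D_def A(2)
    by (rule cdf_wedge_cw[OF uniform_rotations(1)])
       (use pos in \<open>auto simp: polar trig g arctan_minus max.commute\<close>)
  show ?W3 unfolding D_def A(3)
    by (rule cdf_wedge_ccw[OF uniform_rotations(2)])
       (use pos in \<open>auto simp: polar trig g acos\<close>)
  show ?W4 unfolding D_def A(4)
    by (rule cdf_wedge_cw[OF uniform_rotations(3)])
       (use pos in \<open>auto simp: polar trig g acos arctan_minus\<close>)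
  show ?W5 unfolding D_def A(5)
    by (rule cdf_wedge_cw[OF uniform_rotations(4)])
       (use pos in \<open>auto simp: polar trig flip asin\<close>)
  show ?W6 unfolding D_def A(6)
    by (rule cdf_wedge_ccw[OF uniform_rotations(5)])
       (use pos flip(2) in \<open>auto simp: polar trig asin\<close>)
  show ?W7 unfolding D_def A(7)
    by (rule cdf_wedge_cw[OF uniform_rotations(6)])
       (use pos flip(3) in \<open>auto simp: polar trig asin\<close>)
  show ?W8 unfolding D_def A(8)
    by (rule cdf_wedge_ccw[OF uniform_rotations(7)])
       (use pos flip(4) in \<open>auto simp: polar trig asin\<close>)
qed

end

section \<open>Assembly of the distribution function\<close>

text \<open>Regroups the formula by wedge: the common angular sum is distributed over the tangent
  and cotangent indices, the area is factored out, and the minus sign moves into the cotangent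
  terms.\<close>

lemma sum_split_wedges:
  fixes p s q u v :: "nat \<Rightarrow> real" and c A :: real
  shows "c / (2 * A) * (\<Sum>i = 1..8. p i) + (\<Sum>i = 1..4. s i / (2 * A) * q i * u i)
      - (\<Sum>i = 5..8. s i / (2 * A) * q i * v i)
    = ((\<Sum>i = 1..4. c / 2 * p i + s i / 2 * q i * u i)
      + (\<Sum>i = 5..8. c / 2 * p i + s i / 2 * q i * - v i)) / A"
proof -
  have "(\<Sum>i = 1..8. p i) = (\<Sum>i = 1..4. p i) + (\<Sum>i = 5..8. p i)"
    using sum.ub_add_nat[of 1 4 p 4] by simp
  then show ?thesis
    by (simp add: sum.distrib sum_subtractf diff_divide_distrib sum_distrib_left sum_divide_distrib
        add_divide_distrib distrib_left mult_ac)
qed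

theorem theorem1:
  fixes M :: "'a measure"
    and V :: "'a \<Rightarrow> real \<times> real"
    and R \<Theta> :: "'a \<Rightarrow> real"
    and lx ly ux uy r \<theta> :: real
  assumes "prob_space M"
    and "lx > 0" and "ly > 0"
    and "\<bar>ux\<bar> < lx / 2" and "\<bar>uy\<bar> < ly / 2"
    and "V \<in> borel_measurable M"
    and "distr M lborel V =
           uniform_measure lborel ({- lx / 2..lx / 2} \<times> {- ly / 2..ly / 2})"
    and "R \<in> borel_measurable M" and "\<Theta> \<in> borel_measurable M"
    and "\<And>\<omega>. \<omega> \<in> space M \<Longrightarrow> R \<omega> \<ge> 0"
    and "\<And>\<omega>. \<omega> \<in> space M \<Longrightarrow> \<Theta> \<omega> \<in> {0..<2 * pi}"
    and "\<And>\<omega>. \<omega> \<in> space M \<Longrightarrow>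
           V \<omega> - (ux, uy) = (R \<omega> * cos (\<Theta> \<omega>), R \<omega> * sin (\<Theta> \<omega>))"
    and "r > 0" and "\<theta> \<in> {0..2 * pi}"
  shows "\<P>(\<omega> in M. R \<omega> \<le> r \<and> \<Theta> \<omega> \<le> \<theta>) =
    r\<^sup>2 / (2 * lx * ly) *
      (\<Sum>i = 1..8.
         of_bool (r < side_dist lx ly ux uy i) *
           pos_part (min \<theta> (snd (chi_less lx ly ux uy i)) - fst (chi_less lx ly ux uy i))
       + of_bool (r \<ge> side_dist lx ly ux uy i) *
           pos_part (min \<theta> (snd (chi_ge lx ly ux uy i r)) - fst (chi_ge lx ly ux uy i r)))
    + (\<Sum>i = 1..4.
         (side_dist lx ly ux uy i)\<^sup>2 / (2 * lx * ly) * of_bool (r \<ge> side_dist lx ly ux uy i) *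
           incr tan (fst (mu lx ly ux uy i r)) (min \<theta> (snd (mu lx ly ux uy i r))))
    - (\<Sum>i = 5..8.
         (side_dist lx ly ux uy i)\<^sup>2 / (2 * lx * ly) * of_bool (r \<ge> side_dist lx ly ux uy i) *
           incr cot (fst (mu lx ly ux uy i r)) (min \<theta> (snd (mu lx ly ux uy i r))))"
proof -
  define xp xm yp ym where d: "xp = h_plus lx ux" "xm = h_minus lx ux" "yp = h_plus ly uy" "ym = h_minus ly uy"
  define W where "W = (\<lambda>\<omega>. - (ux, uy) + V \<omega>)"
  have signs: "0 < xp" "xm < 0" "0 < yp" "ym < 0"
    using assms(4,5) by (auto simp: d h_plus_def h_minus_def)
  have box: "(\<lambda>w. (ux, uy) + w) -` ({- lx / 2..lx / 2} \<times> {- ly / 2..ly / 2}) = {- (- xm)..xp} \<times> {- (- ym)..yp}"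
    by (auto simp: d h_plus_def h_minus_def)
  \<comment> \<open>Translation by the reference point, with the opposite translation as left
    inverse.\<close>
  have "distr M lborel (\<lambda>\<omega>. - (ux, uy) + V \<omega>) =
      uniform_measure lborel ((\<lambda>w. (ux, uy) + w) -` ({- lx / 2..lx / 2} \<times> {- ly / 2..ly / 2}))"
    using assms(6,7)
    by (intro distr_uniform_measure_transport[where L = "\<lambda>v. - (ux, uy) + v"] box_measurable lborel_distr_plus)
       (auto simp: zero_prod_def)
  then have unif: "uniform_on_box M W xp (- xm) yp (- ym)"
    unfolding uniform_on_box_def W_def box using assms(6) by simp
  interpret prob_space M by fact
  interpret polar_rectangle M W R \<Theta> xp xm yp ym r
  proof
    show "0 \<le> \<Theta> \<omega> \<and> \<Theta> \<omega> < 2 * pi" if "\<omega> \<in> space M" for \<omega>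
      using assms(11)[OF that] by simp
    show "W \<omega> = (R \<omega> * cos (\<Theta> \<omega>), R \<omega> * sin (\<Theta> \<omega>))" if "\<omega> \<in> space M" for \<omega>
      using assms(12)[OF that] by (simp only: W_def diff_conv_add_uminus add.commute)
  qed (fact unif signs assms)+
  let ?h = "side_dist lx ly ux uy" and ?cl = "chi_less lx ly ux uy"
  let ?T = "\<lambda>f i. wedge_term f (?h i) r \<theta> (?cl i) (chi_ge lx ly ux uy i r) (mu lx ly ux uy i r)"
  let ?A = "lx * ly"
  let ?D = "\<lambda>i. cdf (min \<theta> (snd (?cl i))) - cdf (min \<theta> (fst (?cl i)))"
  have A: "?A = (xp - xm) * (yp - ym)" by (simp add: d h_plus_def h_minus_def)
  note defs = side_dist_def chi_less_def chi_ge_def mu_def Let_def corner1_def corner2_def corner3_def corner4_def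
  have T: "?T tan 1 = ?A * ?D 1" "?T tan 2 = ?A * ?D 2" "?T tan 3 = ?A * ?D 3" "?T tan 4 = ?A * ?D 4"
    "?T (\<lambda>x. - cot x) 5 = ?A * ?D 5" "?T (\<lambda>x. - cot x) 6 = ?A * ?D 6"
    "?T (\<lambda>x. - cot x) 7 = ?A * ?D 7" "?T (\<lambda>x. - cot x) 8 = ?A * ?D 8"
    unfolding A
    subgoal using wedge_term_eq_cdf_increment(1)[of \<theta>] by (simp add: defs d[symmetric])
    subgoal using wedge_term_eq_cdf_increment(2)[of \<theta>] by (simp add: defs d[symmetric])
    subgoal using wedge_term_eq_cdf_increment(3)[of \<theta>] by (simp add: defs d[symmetric])
    subgoal using wedge_term_eq_cdf_increment(4)[of \<theta>] by (simp add: defs d[symmetric])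
    subgoal using wedge_term_eq_cdf_increment(5)[of \<theta>] by (simp add: defs d[symmetric])
    subgoal using wedge_term_eq_cdf_increment(6)[of \<theta>] by (simp add: defs d[symmetric])
    subgoal using wedge_term_eq_cdf_increment(7)[of \<theta>] by (simp add: defs d[symmetric])
    subgoal using wedge_term_eq_cdf_increment(8)[of \<theta>] by (simp add: defs d[symmetric])
    done
  have idx: "{1..4} = {1, 2, 3, 4 :: nat}" "{5..8} = {5, 6, 7, 8 :: nat}" by auto
  have "(\<Sum>i = 1..4. ?T tan i) + (\<Sum>i = 5..8. ?T (\<lambda>x. - cot x) i)
      = ?A * ((\<Sum>i = 1..4. ?D i) + (\<Sum>i = 5..8. ?D i))"
    unfolding idx by (simp add: T distrib_left del: One_nat_def)
  \<comment> \<open>In the angular order 1, 5, 6, 4, 3, 7, 8, 2 each wedge ends where the next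
    begins, so all inner values cancel.\<close>
  also have "(\<Sum>i = 1..4. ?D i) + (\<Sum>i = 5..8. ?D i) = cdf (min \<theta> (2 * pi)) - cdf (min \<theta> 0)"
    unfolding idx by (simp add: chi_less_def Let_def)
  \<comment> \<open>The range of \<open>\<theta>\<close> resolves both minima; the lower end
    vanishes because the ray of azimuth 0 has probability 0.\<close>
  also have "\<dots> = cdf \<theta>" using assms(14) by (simp add: cdf_0 min_absorb1 min_absorb2)
  finally have "cdf \<theta> = ((\<Sum>i = 1..4. ?T tan i) + (\<Sum>i = 5..8. ?T (\<lambda>x. - cot x) i)) / ?A"
    using assms(2,3) by (simp add: field_simps)
  moreover have "incr (\<lambda>x. - cot x) s t = - incr cot s t" for s t :: real by (simp add: incr_def)
  ultimately show ?thesis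
    by (simp only: cdf_def wedge_term_def mult.assoc[of 2 lx ly] sum_split_wedges)
qed

end
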